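(* For every integer $m\ge 1$ there is a constant $C>0$ depending only on $m$ such that the following holds. Let $n\ge 1$ and let $\mathbb{Z}_m$ act on $\mathbb{C}^n$ through a unitary representation. Then there is a $\mathbb{Z}_m$-invariant map $\Phi:\mathbb{C}^n\to\mathbb{C}^{2n+1}$ whose induced map $\tilde\Phi:\mathbb{C}^n/\mathbb{Z}_m\to\mathbb{C}^{2n+1}$ is injective, and such that $$\|\Phi(x)-\Phi(y)\|\le C\, d_{\mathbb{Z}_m}([x],[y])\qquad\text{for every }x,y\in\mathbb{C}^n .$$
   Context: A unitary representation of a group $G$ on $\mathbb{C}^n$ is a group homomorphism $\sigma:G\to U(n)$; it gives the action $gx=\sigma(g)x$. $\mathbb{C}^n/G$ is the space of orbits, $[x]$ is the orbit of $x$, and $d_G([x],[y])=\inf_{g\in G}\|x-gy\|$ with the Euclidean norm. A map $\Phi$ on $\mathbb{C}^n$ is $G$-invariant if $\Phi(gx)=\Phi(x)$ for all $g\in G$, $x\in\mathbb{C}^n$; it then induces the map $\tilde\Phi([x])=\Phi(x)$ on $\mathbb{C}^n/G$. $\mathbb{Z}_m$ is the cyclic group of order $m$. *)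

theory Defs
  imports
    "Jordan_Normal_Form.Schur_Decomposition"
    "HOL-Algebra.Elementary_Groups"
    "HOL-Algebra.Group_Action"
    "HOL-Analysis.L2_Norm"
begin

text \<open>The dimension \<open>n\<close> is quantified inside the statement, so \<open>\<complex>\<^sup>n\<close> is rendered as
  \<open>carrier_vec n\<close>, the complex vectors of dimension \<open>n\<close>.\<close>

definition eucl_norm :: "complex vec \<Rightarrow> real" where
  "eucl_norm x = L2_set (\<lambda>i. cmod (x $ i)) {..<dim_vec x}"

definition unitary_group :: "nat \<Rightarrow> complex mat monoid" where
  "unitary_group n =
     \<lparr>carrier = {U \<in> carrier_mat n n. mat_adjoint U * U = 1\<^sub>m n \<and> U * mat_adjoint U = 1\<^sub>m n},
      monoid.mult = (*), one = 1\<^sub>m n\<rparr>"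

definition unitary_rep :: "('g, 'b) monoid_scheme \<Rightarrow> nat \<Rightarrow> ('g \<Rightarrow> complex mat) \<Rightarrow> bool" where
  "unitary_rep G n \<sigma> \<longleftrightarrow> group G \<and> \<sigma> \<in> hom G (unitary_group n)"

definition rep_action :: "('g \<Rightarrow> complex mat) \<Rightarrow> 'g \<Rightarrow> complex vec \<Rightarrow> complex vec" where
  "rep_action \<sigma> g x = \<sigma> g *\<^sub>v x"

definition orbit_space ::
    "('g, 'b) monoid_scheme \<Rightarrow> nat \<Rightarrow> ('g \<Rightarrow> complex mat) \<Rightarrow> complex vec set set" where
  "orbit_space G n \<sigma> = orbits G (carrier_vec n) (rep_action \<sigma>)"

text \<open>The distance between the orbits of \<open>x\<close> and \<open>y\<close>, as a function of the representatives;
  for a unitary representation it depends only on the two orbits.\<close>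

definition orbit_dist ::
    "('g, 'b) monoid_scheme \<Rightarrow> ('g \<Rightarrow> complex mat) \<Rightarrow> complex vec \<Rightarrow> complex vec \<Rightarrow> real" where
  "orbit_dist G \<sigma> x y = (INF g\<in>carrier G. eucl_norm (x - rep_action \<sigma> g y))"

definition invariant_map ::
    "('g, 'b) monoid_scheme \<Rightarrow> nat \<Rightarrow> ('g \<Rightarrow> complex mat) \<Rightarrow> (complex vec \<Rightarrow> 'c) \<Rightarrow> bool" where
  "invariant_map G n \<sigma> \<Phi> \<longleftrightarrow>
     (\<forall>g\<in>carrier G. \<forall>x\<in>carrier_vec n. \<Phi> (rep_action \<sigma> g x) = \<Phi> x)"

text \<open>The value of the induced map at an orbit is the unique element of the image of the orbit,
  see \<open>induced_map_orbit\<close> below.\<close>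

definition induced_map :: "(complex vec \<Rightarrow> 'c) \<Rightarrow> complex vec set \<Rightarrow> 'c" where
  "induced_map \<Phi> X = the_elem (\<Phi> ` X)"

lemma induced_map_orbit:
  assumes "group G" and inv: "invariant_map G n \<sigma> \<Phi>" and x: "x \<in> carrier_vec n"
  shows "induced_map \<Phi> (orbit G (rep_action \<sigma>) x) = \<Phi> x"
proof -
  have "\<one>\<^bsub>G\<^esub> \<in> carrier G"
    using \<open>group G\<close> by (simp add: group.is_monoid)
  then have "orbit G (rep_action \<sigma>) x \<noteq> {}"
    unfolding orbit_def by blast
  moreover have "\<Phi> y = \<Phi> x" if "y \<in> orbit G (rep_action \<sigma>) x" for y
    using that inv x unfolding orbit_def invariant_map_def by blast
  ultimately have "\<Phi> ` orbit G (rep_action \<sigma>) x = {\<Phi> x}"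
    by auto
  then show ?thesis
    by (simp add: induced_map_def)
qed

lemma mat_adjoint_carrier:
  "A \<in> carrier_mat n m \<Longrightarrow> mat_adjoint A \<in> carrier_mat m n"
  unfolding mat_adjoint_def by auto

lemma mat_adjoint_index:
  "A \<in> carrier_mat n m \<Longrightarrow> i < m \<Longrightarrow> j < n \<Longrightarrow> mat_adjoint A $$ (i, j) = conjugate (A $$ (j, i))"
  unfolding mat_adjoint_def mat_of_rows_def by auto

lemma mat_adjoint_twice:
  assumes "A \<in> carrier_mat n m" shows "mat_adjoint (mat_adjoint A) = A"
  using assms mat_adjoint_carrier[OF assms] mat_adjoint_carrier[OF mat_adjoint_carrier[OF assms]]
  by (intro eq_matI) (auto simp: mat_adjoint_index[of _ m n] mat_adjoint_index[of _ n m])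

lemma mat_adjoint_mult:
  fixes A B :: "complex mat"
  assumes A: "A \<in> carrier_mat n n" and B: "B \<in> carrier_mat n n"
  shows "mat_adjoint (A * B) = mat_adjoint B * mat_adjoint A"
proof (rule eq_matI)
  fix i j
  assume "i < dim_row (mat_adjoint B * mat_adjoint A)"
    and "j < dim_col (mat_adjoint B * mat_adjoint A)"
  then have ij: "i < n" "j < n"
    using mat_adjoint_carrier[OF A] mat_adjoint_carrier[OF B] by auto
  have "A * B \<in> carrier_mat n n"
    using A B by simp
  then show "mat_adjoint (A * B) $$ (i, j) = (mat_adjoint B * mat_adjoint A) $$ (i, j)"
    using A B ij mat_adjoint_carrier[OF A] mat_adjoint_carrier[OF B]
    by (auto simp: mat_adjoint_index[of _ n n] scalar_prod_def mult.commute intro!: sum.cong)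
qed (use A B mat_adjoint_carrier[of _ n n] in \<open>auto simp: mat_adjoint_def\<close>)

lemma group_unitary_group: "group (unitary_group n)"
proof (rule groupI)
  fix x y
  assume "x \<in> carrier (unitary_group n)" "y \<in> carrier (unitary_group n)"
  then have x: "x \<in> carrier_mat n n" "mat_adjoint x * x = 1\<^sub>m n" "x * mat_adjoint x = 1\<^sub>m n"
    and y: "y \<in> carrier_mat n n" "mat_adjoint y * y = 1\<^sub>m n" "y * mat_adjoint y = 1\<^sub>m n"
    by (auto simp: unitary_group_def)
  note c = x(1) y(1) mat_adjoint_carrier[OF x(1)] mat_adjoint_carrier[OF y(1)]
  have "mat_adjoint (x * y) * (x * y) = mat_adjoint y * ((mat_adjoint x * x) * y)"
    using c by (simp add: mat_adjoint_mult[of _ n] assoc_mult_mat[of _ n n _ n _ n])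
  moreover have "(x * y) * mat_adjoint (x * y) = x * ((y * mat_adjoint y) * mat_adjoint x)"
    using c by (simp add: mat_adjoint_mult[of _ n] assoc_mult_mat[of _ n n _ n _ n])
  ultimately show "x \<otimes>\<^bsub>unitary_group n\<^esub> y \<in> carrier (unitary_group n)"
    using x y c by (simp add: unitary_group_def)
next
  have "mat_adjoint (1\<^sub>m n) = (1\<^sub>m n :: complex mat)"
    using mat_adjoint_carrier[of "1\<^sub>m n" n n]
    by (intro eq_matI) (auto simp: mat_adjoint_index[of _ n n])
  then show "\<one>\<^bsub>unitary_group n\<^esub> \<in> carrier (unitary_group n)"
    by (simp add: unitary_group_def)
next
  fix x
  assume "x \<in> carrier (unitary_group n)"
  then show "\<exists>y\<in>carrier (unitary_group n). y \<otimes>\<^bsub>unitary_group n\<^esub> x = \<one>\<^bsub>unitary_group n\<^esub>"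
    by (intro bexI[of _ "mat_adjoint x"])
      (auto simp: unitary_group_def mat_adjoint_carrier mat_adjoint_twice[of _ n n])
qed (auto simp: unitary_group_def assoc_mult_mat[of _ n n _ n _ n])

end

theory Submission
  imports Defs "HOL-Analysis.Euclidean_Space"
begin

text \<open>
  Expand a complex vector into the real polynomial \<open>q\<^sub>x\<close> whose coefficients are the real and
  imaginary parts of its entries, and consider the max filters
  \<open>f\<^sub>t x = Max\<^sub>g q\<^bsub>g x\<^esub>(t)\<close>. They are invariant and Lipschitz, and \<open>f\<^sub>t x = f\<^sub>t y\<close> forces the
  polynomial \<open>q\<^bsub>g x - h y\<^esub>\<close> to vanish at \<open>t\<close> for some \<open>g, h\<close>. For given \<open>g, h\<close> this is one linear
  condition on the pair \<open>(x, y)\<close>, which ranges over a real space of dimension \<open>4 n\<close>. A point \<open>t\<close> can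
  be chosen such that none of finitely many such conditions is vacuous on any of finitely many
  subspaces, unless \<open>g x = h y\<close> identically on that subspace. Hence each of \<open>4 n\<close> successively
  chosen points lowers the dimension of the set of pairs that are not yet separated, and finally only
  pairs in the same orbit remain. The \<open>4 n\<close> real values fit into \<open>2 n + 1\<close> complex coordinates, and
  since injectivity survives scaling, the constant can be normalised to \<open>1\<close>.
\<close>

section \<open>Generic evaluation points for spans of polynomials\<close>

text \<open>Induction on the number of generators: the first point \<open>s\<close> is a root of no
  nonzero \<open>w k i\<close>, so a combination whose component \<open>i\<close> vanishes at
  \<open>s\<close> either has all \<open>w k i\<close> zero or satisfies a nontrivial linear
  relation that eliminates one generator. A finite set \<open>W\<close> of families is needed for
  the induction, since the same later points must serve every resulting branch.\<close>

lemma generic_evaluation_points: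
  fixes W :: "('k set \<times> ('k \<Rightarrow> 'i \<Rightarrow> 'a::field_char_0 poly)) set"
  assumes "finite I" "I \<noteq> {}" "finite W"
    and "\<And>K w. (K, w) \<in> W \<Longrightarrow> finite K \<and> card K \<le> d"
  shows "\<exists>t::nat \<Rightarrow> 'a. \<forall>(K, w)\<in>W. \<forall>c.
    (\<forall>j<d. \<exists>i\<in>I. poly (\<Sum>k\<in>K. smult (c k) (w k i)) (t j) = 0) \<longrightarrow>
    (\<exists>i\<in>I. (\<Sum>k\<in>K. smult (c k) (w k i)) = 0)"
  using assms(3,4)
proof (induction d arbitrary: W)
  case 0
  then have "K = {}" if "(K, w) \<in> W" for K w
    using that by fastforce
  then show ?case
    using \<open>I \<noteq> {}\<close> by fastforce
next
  case (Suc d)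
  let ?R = "\<Union>(K, w)\<in>W. \<Union>k\<in>K. \<Union>i\<in>I. if w k i = 0 then {} else {s. poly (w k i) s = 0}"
  have "finite ?R"
    using Suc.prems \<open>finite I\<close> by (auto intro!: finite_UN_I poly_roots_finite)
  then obtain s where s: "s \<notin> ?R"
    using ex_new_if_finite infinite_UNIV_char_0 by blast
  then have nz: "poly (w k i) s \<noteq> 0"
    if "(K, w) \<in> W" "k \<in> K" "i \<in> I" "w k i \<noteq> 0" for K w k i
    using that by fastforce
  define b where "b K w i = (SOME k. k \<in> K \<and> w k i \<noteq> 0)"
    for K :: "'k set" and w :: "'k \<Rightarrow> 'i \<Rightarrow> 'a poly" and i
  \<comment> \<open>The hyperplane in the span of \<open>w\<close> on which component \<open>i\<close> vanishes at \<open>s\<close>, obtained by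
    eliminating the generator with index \<open>b K w i\<close>.\<close>
  define r where "r = (\<lambda>((K, w), i). (K - {b K w i}, \<lambda>k i'. w k i' -
      smult (poly (w k i) s / poly (w (b K w i) i) s) (w (b K w i) i')))"
  \<comment> \<open>Which component vanishes at \<open>s\<close> depends on the coefficients, so the
    reduced families for all \<open>i\<close> are collected before the remaining points are
    chosen.\<close>
  define W' where
    "W' = r ` {((K, w), i). (K, w) \<in> W \<and> i \<in> I \<and> (\<exists>k\<in>K. w k i \<noteq> 0)}"
  have b: "b K w i \<in> K" "w (b K w i) i \<noteq> 0" if "\<exists>k\<in>K. w k i \<noteq> 0" for K w i
    using someI_ex[of "\<lambda>k. k \<in> K \<and> w k i \<noteq> 0"] that unfolding b_def by blast+
  have "finite W'"
    unfolding W'_def using Suc.prems(1) \<open>finite I\<close>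
    by (intro finite_imageI) (rule finite_subset[of _ "W \<times> I"], auto)
  moreover have "finite K' \<and> card K' \<le> d" if "(K', w') \<in> W'" for K' w'
  proof -
    from that obtain K w i where K: "K' = K - {b K w i}" "(K, w) \<in> W" "\<exists>k\<in>K. w k i \<noteq> 0"
      unfolding W'_def r_def by auto
    then show ?thesis
      using Suc.prems(2)[OF K(2)] b(1)[where K = K and w = w and i = i, OF K(3)] by (simp add: le_diff_conv)
  qed
  ultimately obtain t where t: "\<And>K' w' c. (K', w') \<in> W' \<Longrightarrow>
      \<forall>j<d. \<exists>i\<in>I. poly (\<Sum>k\<in>K'. smult (c k) (w' k i)) (t j) = 0 \<Longrightarrow>
      \<exists>i\<in>I. (\<Sum>k\<in>K'. smult (c k) (w' k i)) = 0"
    using Suc.IH[of W'] by blast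
  have "\<exists>i\<in>I. (\<Sum>k\<in>K. smult (c k) (w k i)) = 0"
    if W: "(K, w) \<in> W"
      and van: "\<forall>j<Suc d. \<exists>i\<in>I. poly (\<Sum>k\<in>K. smult (c k) (w k i)) (case_nat s t j) = 0" for K w c
  proof (cases "\<exists>i\<in>I. \<forall>k\<in>K. w k i = 0")
    case True
    then obtain i where i: "i \<in> I" "\<forall>k\<in>K. w k i = 0" by blast
    then have "(\<Sum>k\<in>K. smult (c k) (w k i)) = 0" by simp
    then show ?thesis using i(1) by blast
  next
    \<comment> \<open>Whichever component vanishes at \<open>s\<close>, some generator is now
      nonzero there and can be eliminated.\<close>
    case False
    from van[rule_format, of 0] obtain i
      where i: "i \<in> I" "poly (\<Sum>k\<in>K. smult (c k) (w k i)) s = 0"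
      by auto
    let ?b = "b K w i"
    let ?w' = "\<lambda>k i'. w k i' - smult (poly (w k i) s / poly (w ?b i) s) (w ?b i')"
    have ex: "\<exists>k\<in>K. w k i \<noteq> 0"
      using False i(1) by blast
    note bK = b[where K = K and w = w and i = i, OF ex]
    have b_nz: "poly (w ?b i) s \<noteq> 0"
      using nz[OF W bK(1) i(1) bK(2)] .
    have fin: "finite K"
      using Suc.prems(2)[OF W] by blast
    have "(K - {?b}, ?w') \<in> W'"
      unfolding W'_def by (rule image_eqI[where x = "((K, w), i)"]) (use W i ex in \<open>auto simp: r_def\<close>)
    note t' = t[OF this, of c]
    \<comment> \<open>Vanishing at \<open>s\<close> forces the corrections in the new generators to
      contribute \<open>w ?b i'\<close> with total coefficient \<open>c ?b\<close>, so the same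
      \<open>c\<close> represents the combination without the index \<open>?b\<close>.\<close>
    have eq: "(\<Sum>k\<in>K - {?b}. smult (c k) (?w' k i')) = (\<Sum>k\<in>K. smult (c k) (w k i'))" for i'
    proof -
      have "(\<Sum>k\<in>K - {?b}. c k * (poly (w k i) s / poly (w ?b i) s))
        = (\<Sum>k\<in>K - {?b}. c k * poly (w k i) s) / poly (w ?b i) s"
        by (simp add: sum_divide_distrib)
      also have "(\<Sum>k\<in>K - {?b}. c k * poly (w k i) s) = - (c ?b * poly (w ?b i) s)"
        using i(2) by (simp add: poly_sum sum.remove[OF fin bK(1)] eq_neg_iff_add_eq_0 add.commute)
      also have "- (c ?b * poly (w ?b i) s) / poly (w ?b i) s = - c ?b"
        using b_nz by simp
      finally have *: "(\<Sum>k\<in>K - {?b}. c k * (poly (w k i) s / poly (w ?b i) s)) = - c ?b" .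
      have "(\<Sum>k\<in>K - {?b}. smult (c k) (?w' k i'))
        = (\<Sum>k\<in>K - {?b}. smult (c k) (w k i'))
          - smult (\<Sum>k\<in>K - {?b}. c k * (poly (w k i) s / poly (w ?b i) s)) (w ?b i')"
        by (simp add: smult_diff_right sum_subtractf smult_sum)
      then show ?thesis
        unfolding * by (simp add: sum.remove[OF fin bK(1)])
    qed
    have "\<exists>i\<in>I. poly (\<Sum>k\<in>K. smult (c k) (w k i)) (t j) = 0" if "j < d" for j
      using van[rule_format, of "Suc j"] that by simp
    then show ?thesis
      using t' unfolding eq by blast
  qed
  then show ?case
    by (intro exI[of _ "case_nat s t"]) (simp only: Ball_def split_paired_All prod.case, blast)
qed

section \<open>Complex vectors as real polynomials\<close>

text \<open>The \<open>2 * n\<close> real coordinates become coefficients at distinct degrees.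
  Entries are passed as a function, so that real linearity can be stated pointwise.\<close>

definition real_poly_of :: "nat \<Rightarrow> (nat \<Rightarrow> complex) \<Rightarrow> real poly" where
  "real_poly_of n f = (\<Sum>r<n. monom (Re (f r)) (2 * r) + monom (Im (f r)) (2 * r + 1))"

lemma real_poly_of_diff:
  "real_poly_of n (\<lambda>r. f r - g r) = real_poly_of n f - real_poly_of n g"
  by (simp add: real_poly_of_def sum_subtractf flip: diff_monom add_diff_add)

lemma real_poly_of_sum_scaleR:
  "real_poly_of n (\<lambda>r. \<Sum>k\<in>K. c k *\<^sub>R f k r) = (\<Sum>k\<in>K. smult (c k) (real_poly_of n (f k)))"
proof -
  have "real_poly_of n (\<lambda>r. \<Sum>k\<in>K. c k *\<^sub>R f k r)
    = (\<Sum>r<n. \<Sum>k\<in>K. smult (c k) (monom (Re (f k r)) (2 * r) + monom (Im (f k r)) (2 * r + 1)))"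
    unfolding real_poly_of_def
    by (intro sum.cong refl) (simp add: monom_sum sum.distrib smult_add_right smult_monom)
  also have "\<dots> = (\<Sum>k\<in>K. smult (c k) (real_poly_of n (f k)))"
    unfolding real_poly_of_def smult_sum2 by (rule sum.swap)
  finally show ?thesis .
qed

text \<open>Injectivity of the encoding: by the parity of the exponent, each coefficient comes from
  a single real or imaginary part.\<close>

lemma real_poly_of_eq_0D:
  assumes "real_poly_of n f = 0" "r < n"
  shows "f r = 0"
proof -
  have "2 * r' \<noteq> Suc (2 * r)" "Suc (2 * r') \<noteq> 2 * r" for r'
    by presburger+
  then have "coeff (real_poly_of n f) (2 * r) = Re (f r)"
    and "coeff (real_poly_of n f) (2 * r + 1) = Im (f r)"
    using assms(2) by (simp_all add: real_poly_of_def coeff_sum sum.distrib)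
  then show ?thesis
    using assms(1) by (simp add: complex_eq_iff)
qed

lemma abs_poly_real_poly_of_le:
  assumes "\<And>r. r < n \<Longrightarrow> cmod (f r) \<le> b r"
  shows "\<bar>poly (real_poly_of n f) t\<bar> \<le> (\<Sum>r<n. (\<bar>t\<bar> ^ (2 * r) + \<bar>t\<bar> ^ (2 * r + 1)) * b r)"
proof -
  have "\<bar>poly (real_poly_of n f) t\<bar>
      \<le> (\<Sum>r<n. \<bar>Re (f r) * t ^ (2 * r) + Im (f r) * t ^ (2 * r + 1)\<bar>)"
    unfolding real_poly_of_def poly_sum poly_add poly_monom by (rule sum_abs)
  also have "\<dots> \<le> (\<Sum>r<n. (\<bar>t\<bar> ^ (2 * r) + \<bar>t\<bar> ^ (2 * r + 1)) * b r)"
  proof (rule sum_mono)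
    fix r assume "r \<in> {..<n}"
    then have "\<bar>Re (f r)\<bar> \<le> b r" "\<bar>Im (f r)\<bar> \<le> b r"
      using assms abs_Re_le_cmod abs_Im_le_cmod order_trans by (metis lessThan_iff)+
    then have "\<bar>Re (f r)\<bar> * \<bar>t\<bar> ^ (2 * r) + \<bar>Im (f r)\<bar> * \<bar>t\<bar> ^ (2 * r + 1)
      \<le> b r * \<bar>t\<bar> ^ (2 * r) + b r * \<bar>t\<bar> ^ (2 * r + 1)"
      by (intro add_mono mult_right_mono) auto
    moreover have "\<bar>Re (f r) * t ^ (2 * r) + Im (f r) * t ^ (2 * r + 1)\<bar>
      \<le> \<bar>Re (f r)\<bar> * \<bar>t\<bar> ^ (2 * r) + \<bar>Im (f r)\<bar> * \<bar>t\<bar> ^ (2 * r + 1)"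
      by (rule order_trans[OF abs_triangle_ineq]) (simp only: abs_mult power_abs order_refl)
    ultimately show "\<bar>Re (f r) * t ^ (2 * r) + Im (f r) * t ^ (2 * r + 1)\<bar>
      \<le> (\<bar>t\<bar> ^ (2 * r) + \<bar>t\<bar> ^ (2 * r + 1)) * b r"
      by (simp add: algebra_simps)
  qed
  finally show ?thesis .
qed

section \<open>Norm estimates\<close>

lemma cmod_le_eucl_norm: "i < dim_vec x \<Longrightarrow> cmod (x $ i) \<le> eucl_norm x"
  unfolding eucl_norm_def by (rule member_le_L2_set) auto

lemma eucl_norm_le_sum: "eucl_norm x \<le> (\<Sum>i<dim_vec x. cmod (x $ i))"
  unfolding eucl_norm_def by (rule L2_set_le_sum) auto

lemma eucl_norm_nonneg: "eucl_norm x \<ge> 0"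
  unfolding eucl_norm_def by simp

text \<open>A crude row-sum bound is enough, because the final map is rescaled.\<close>

lemma cmod_mult_mat_vec_le:
  assumes "A \<in> carrier_mat n n" "x \<in> carrier_vec n" "r < n"
  shows "cmod ((A *\<^sub>v x) $ r) \<le> (\<Sum>l<n. cmod (A $$ (r, l))) * eucl_norm x"
proof -
  have "cmod ((A *\<^sub>v x) $ r) \<le> (\<Sum>l<n. cmod (A $$ (r, l) * x $ l))"
    using assms by (auto simp: scalar_prod_def lessThan_atLeast0 intro: sum_norm_le)
  also have "\<dots> \<le> (\<Sum>l<n. cmod (A $$ (r, l)) * eucl_norm x)"
    using assms(2) by (intro sum_mono) (auto simp: norm_mult intro!: mult_left_mono cmod_le_eucl_norm)
  finally show ?thesis
    by (simp add: sum_distrib_right)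
qed

text \<open>A finite maximum is nonexpansive for the uniform distance; the one-sided estimate is
  applied in both directions.\<close>

lemma abs_Max_image_diff_le:
  fixes f g :: "'a \<Rightarrow> real"
  assumes "finite A" "A \<noteq> {}" "\<And>a. a \<in> A \<Longrightarrow> \<bar>f a - g a\<bar> \<le> e"
  shows "\<bar>Max (f ` A) - Max (g ` A)\<bar> \<le> e"
proof -
  have "Max (f ` A) \<le> Max (g ` A) + e" if "\<And>a. a \<in> A \<Longrightarrow> \<bar>f a - g a\<bar> \<le> e" for f g :: "'a \<Rightarrow> real"
  proof (rule Max.boundedI)
    fix v assume "v \<in> f ` A"
    then obtain a where a: "a \<in> A" "v = f a" by blast
    have "g a \<le> Max (g ` A)"
      using a assms(1) by simp
    then show "v \<le> Max (g ` A) + e"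
      using that[OF a(1)] a(2) by linarith
  qed (use assms in auto)
  from this[of f g] this[of g f] assms(3) show ?thesis
    by (simp add: abs_minus_commute abs_le_iff)
qed

section \<open>Max filters of a finite unitary representation\<close>

text \<open>This is the maximum over \<open>g\<close> of the real part of the inner product of
  \<open>g x\<close> with the template whose entry \<open>r\<close> is
  \<open>t ^ (2 * r) + \<i> * t ^ (2 * r + 1)\<close>.\<close>

definition max_filter ::
    "('g, 'b) monoid_scheme \<Rightarrow> nat \<Rightarrow> ('g \<Rightarrow> complex mat) \<Rightarrow> real \<Rightarrow> complex vec \<Rightarrow> real" where
  "max_filter G n \<sigma> t x =
     Max ((\<lambda>g. poly (real_poly_of n (vec_index (rep_action \<sigma> g x))) t) ` carrier G)"

locale finite_unitary_rep =
  fixes G :: "('g, 'b) monoid_scheme" (structure) and n :: nat and \<sigma> :: "'g \<Rightarrow> complex mat"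
  assumes rep: "unitary_rep G n \<sigma>" and finite_carrier: "finite (carrier G)"
begin

sublocale group G
  using rep by (simp add: unitary_rep_def)

lemma rep_carrier: "g \<in> carrier G \<Longrightarrow> \<sigma> g \<in> carrier_mat n n"
  using rep unfolding unitary_rep_def hom_def unitary_group_def by auto

lemma rep_action_carrier:
  "g \<in> carrier G \<Longrightarrow> x \<in> carrier_vec n \<Longrightarrow> rep_action \<sigma> g x \<in> carrier_vec n"
  unfolding rep_action_def using rep_carrier by (metis mult_mat_vec_carrier)

lemma rep_action_mult:
  assumes "g \<in> carrier G" "h \<in> carrier G" "x \<in> carrier_vec n"
  shows "rep_action \<sigma> g (rep_action \<sigma> h x) = rep_action \<sigma> (g \<otimes> h) x"
proof -
  have "\<sigma> (g \<otimes> h) = \<sigma> g * \<sigma> h"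
    using rep assms unfolding unitary_rep_def hom_def unitary_group_def by auto
  then show ?thesis
    unfolding rep_action_def using assms rep_carrier by (metis assoc_mult_mat_vec)
qed

lemma right_translate_carrier:
  assumes "h \<in> carrier G"
  shows "(\<lambda>g. g \<otimes> h) ` carrier G = carrier G"
proof
  show "carrier G \<subseteq> (\<lambda>g. g \<otimes> h) ` carrier G"
  proof
    fix g assume "g \<in> carrier G"
    then show "g \<in> (\<lambda>g. g \<otimes> h) ` carrier G"
      using assms by (intro image_eqI[of _ _ "g \<otimes> inv h"]) (auto simp: m_assoc)
  qed
qed (use assms in auto)

text \<open>Right translation by \<open>h\<close> permutes the group. The arbitrary \<open>F\<close>
  covers both orbits and the values inside a max filter.\<close>

lemma image_rep_action_translate:
  assumes "h \<in> carrier G" "x \<in> carrier_vec n"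
  shows "(\<lambda>g. F (rep_action \<sigma> g (rep_action \<sigma> h x))) ` carrier G
    = (\<lambda>g. F (rep_action \<sigma> g x)) ` carrier G"
proof -
  have "(\<lambda>g. F (rep_action \<sigma> g (rep_action \<sigma> h x))) ` carrier G
    = (\<lambda>g. F (rep_action \<sigma> g x)) ` (\<lambda>g. g \<otimes> h) ` carrier G"
    using assms by (auto simp: rep_action_mult image_image)
  then show ?thesis
    using right_translate_carrier[OF assms(1)] by simp
qed

lemma orbit_rep_action:
  assumes "h \<in> carrier G" "x \<in> carrier_vec n"
  shows "orbit G (rep_action \<sigma>) (rep_action \<sigma> h x) = orbit G (rep_action \<sigma>) x"
  using image_rep_action_translate[OF assms, of "\<lambda>v. v"] unfolding orbit_def image_def by blast

lemma max_filter_invariant: "invariant_map G n \<sigma> (max_filter G n \<sigma> t)"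
  unfolding invariant_map_def max_filter_def
  using image_rep_action_translate[where F = "\<lambda>v. poly (real_poly_of n (vec_index v)) t"] by simp

text \<open>Each function under the maximum is real-linear in the vector; summing their bounds over
  the group gives one constant for all \<open>g\<close>.\<close>

lemma max_filter_lipschitz:
  obtains B where "B \<ge> 0" "\<And>x y. x \<in> carrier_vec n \<Longrightarrow> y \<in> carrier_vec n \<Longrightarrow>
    \<bar>max_filter G n \<sigma> t x - max_filter G n \<sigma> t y\<bar> \<le> B * eucl_norm (x - y)"
proof
  let ?b = "\<lambda>g r. (\<bar>t\<bar> ^ (2 * r) + \<bar>t\<bar> ^ (2 * r + 1)) * (\<Sum>l<n. cmod (\<sigma> g $$ (r, l)))"
  let ?B = "\<Sum>g\<in>carrier G. \<Sum>r<n. ?b g r"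
  have nonneg: "(\<Sum>r<n. ?b g r) \<ge> 0" for g
    by (intro sum_nonneg mult_nonneg_nonneg add_nonneg_nonneg) auto
  show "?B \<ge> 0"
    by (rule sum_nonneg) (rule nonneg)
  fix x y :: "complex vec"
  assume x: "x \<in> carrier_vec n" and y: "y \<in> carrier_vec n"
  show "\<bar>max_filter G n \<sigma> t x - max_filter G n \<sigma> t y\<bar> \<le> ?B * eucl_norm (x - y)"
    unfolding max_filter_def
  proof (rule abs_Max_image_diff_le)
    fix g assume g: "g \<in> carrier G"
    have idx: "rep_action \<sigma> g x $ r - rep_action \<sigma> g y $ r = (\<sigma> g *\<^sub>v (x - y)) $ r" if "r < n" for r
      using x y rep_carrier[OF g] that
      by (simp add: rep_action_def mult_minus_distrib_mat_vec[where nr = n and nc = n])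
    have "\<bar>poly (real_poly_of n (vec_index (rep_action \<sigma> g x))) t
        - poly (real_poly_of n (vec_index (rep_action \<sigma> g y))) t\<bar>
      = \<bar>poly (real_poly_of n (\<lambda>r. rep_action \<sigma> g x $ r - rep_action \<sigma> g y $ r)) t\<bar>"
      by (simp add: real_poly_of_diff)
    also have "\<dots> \<le> (\<Sum>r<n. (\<bar>t\<bar> ^ (2 * r) + \<bar>t\<bar> ^ (2 * r + 1))
        * ((\<Sum>l<n. cmod (\<sigma> g $$ (r, l))) * eucl_norm (x - y)))"
      using x y rep_carrier[OF g]
      by (intro abs_poly_real_poly_of_le) (simp only: idx cmod_mult_mat_vec_le minus_carrier_vec)
    also have "\<dots> = (\<Sum>r<n. ?b g r) * eucl_norm (x - y)"
      by (simp add: sum_distrib_right mult.assoc)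
    also have "\<dots> \<le> ?B * eucl_norm (x - y)"
      using g finite_carrier nonneg
      by (intro mult_right_mono eucl_norm_nonneg member_le_sum) auto
    finally show "\<bar>poly (real_poly_of n (vec_index (rep_action \<sigma> g x))) t
        - poly (real_poly_of n (vec_index (rep_action \<sigma> g y))) t\<bar> \<le> ?B * eucl_norm (x - y)" .
  qed (use finite_carrier one_closed in auto)
qed

text \<open>The generic points are applied to the polynomials of \<open>g x - h y\<close>, with
  components indexed by pairs \<open>(g, h)\<close> and generators by the \<open>4 * n\<close> real
  coordinates of \<open>(x, y)\<close>.\<close>

lemma max_filters_separate:
  obtains t :: "nat \<Rightarrow> real" where
    "\<And>x y. x \<in> carrier_vec n \<Longrightarrow> y \<in> carrier_vec n \<Longrightarrow>
      \<forall>j<4 * n. max_filter G n \<sigma> (t j) x = max_filter G n \<sigma> (t j) y \<Longrightarrow>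
      orbit G (rep_action \<sigma>) x = orbit G (rep_action \<sigma>) y"
proof -
  \<comment> \<open>\<open>Inl\<close> indexes the real coordinates of \<open>x\<close>,
    \<open>Inr\<close> those of \<open>y\<close>; \<open>Basis\<close> has two elements over the
    complex numbers.\<close>
  define K :: "((nat \<times> complex) + (nat \<times> complex)) set"
    where "K = ({..<n} \<times> Basis) <+> ({..<n} \<times> Basis)"
  define w where "w = (\<lambda>k (g, h). real_poly_of n (case k of
      Inl (l, u) \<Rightarrow> \<lambda>r. \<sigma> g $$ (r, l) * u
    | Inr (l, u) \<Rightarrow> \<lambda>r. - (\<sigma> h $$ (r, l) * u)))"
  have K: "finite K \<and> card K \<le> 4 * n"
    unfolding K_def by (simp add: card_Plus)
  obtain t :: "nat \<Rightarrow> real" where t: "\<And>c. \<forall>j<4 * n. \<exists>i\<in>carrier G \<times> carrier G.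
      poly (\<Sum>k\<in>K. smult (c k) (w k i)) (t j) = 0 \<Longrightarrow>
      \<exists>i\<in>carrier G \<times> carrier G. (\<Sum>k\<in>K. smult (c k) (w k i)) = 0"
    using generic_evaluation_points[of "carrier G \<times> carrier G" "{(K, w)}" "4 * n"]
      finite_carrier one_closed K by auto
  show ?thesis
  proof
    fix x y :: "complex vec"
    assume x: "x \<in> carrier_vec n" and y: "y \<in> carrier_vec n"
      and eq: "\<forall>j<4 * n. max_filter G n \<sigma> (t j) x = max_filter G n \<sigma> (t j) y"
    define c where "c = case_sum (\<lambda>(l, u). inner (x $ l) u) (\<lambda>(l, u). inner (y $ l) u)"
    let ?q = "\<lambda>g h. real_poly_of n (\<lambda>r. rep_action \<sigma> g x $ r - rep_action \<sigma> h y $ r)"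
    have entry: "(\<Sum>(l, u)\<in>{..<n} \<times> Basis. inner (z $ l) u *\<^sub>R (\<sigma> g $$ (r, l) * u)) = rep_action \<sigma> g z $ r"
      if "g \<in> carrier G" "z \<in> carrier_vec n" "r < n" for g z r
    proof -
      have "(\<Sum>(l, u)\<in>{..<n} \<times> Basis. inner (z $ l) u *\<^sub>R (\<sigma> g $$ (r, l) * u))
        = (\<Sum>l<n. \<sigma> g $$ (r, l) * (\<Sum>u\<in>Basis. inner (z $ l) u *\<^sub>R u))"
        by (simp add: sum.cartesian_product[symmetric] sum_distrib_left)
      also have "\<dots> = rep_action \<sigma> g z $ r"
        using that rep_carrier[OF that(1)]
        by (simp only: euclidean_representation)
          (auto simp: rep_action_def scalar_prod_def lessThan_atLeast0)
      finally show ?thesis .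
    qed
    have q: "(\<Sum>k\<in>K. smult (c k) (w k (g, h))) = ?q g h" if "g \<in> carrier G" "h \<in> carrier G" for g h
    proof -
      have "(\<Sum>k\<in>K. smult (c k) (w k (g, h))) = real_poly_of n (\<lambda>r. \<Sum>k\<in>K. c k *\<^sub>R (case k of
          Inl (l, u) \<Rightarrow> \<lambda>r. \<sigma> g $$ (r, l) * u | Inr (l, u) \<Rightarrow> \<lambda>r. - (\<sigma> h $$ (r, l) * u)) r)"
        by (simp add: w_def real_poly_of_sum_scaleR)
      also have "\<dots> = real_poly_of n (\<lambda>r.
          (\<Sum>(l, u)\<in>{..<n} \<times> Basis. inner (x $ l) u *\<^sub>R (\<sigma> g $$ (r, l) * u))
          - (\<Sum>(l, u)\<in>{..<n} \<times> Basis. inner (y $ l) u *\<^sub>R (\<sigma> h $$ (r, l) * u)))"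
        unfolding K_def c_def
        by (subst sum.Plus) (auto simp: case_prod_unfold sum_negf)
      also have "\<dots> = ?q g h"
        using that x y unfolding real_poly_of_def by (intro sum.cong refl) (simp only: entry lessThan_iff)
      finally show ?thesis .
    qed
    \<comment> \<open>Both maxima are attained, at some \<open>g\<close> and \<open>h\<close> that
      may change with \<open>j\<close>.\<close>
    have "\<exists>i\<in>carrier G \<times> carrier G. poly (\<Sum>k\<in>K. smult (c k) (w k i)) (t j) = 0" if "j < 4 * n" for j
    proof -
      let ?P = "\<lambda>z g. poly (real_poly_of n (vec_index (rep_action \<sigma> g z))) (t j)"
      have "max_filter G n \<sigma> (t j) z \<in> ?P z ` carrier G" for z
        unfolding max_filter_def using finite_carrier one_closed by (intro Max_in) auto
      from this[of x] this[of y] obtain g h where gh: "g \<in> carrier G" "h \<in> carrier G" "?P x g = ?P y h"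
        using eq \<open>j < 4 * n\<close> by auto
      then show ?thesis
        by (intro bexI[of _ "(g, h)"]) (auto simp: q real_poly_of_diff)
    qed
    \<comment> \<open>Genericity of the points turns the pairs depending on \<open>j\<close> into
      one pair whose polynomial is identically zero.\<close>
    then obtain g h where gh: "g \<in> carrier G" "h \<in> carrier G" "?q g h = 0"
      using t[of c] q by auto
    have "rep_action \<sigma> g x = rep_action \<sigma> h y"
      using real_poly_of_eq_0D[OF gh(3)] rep_action_carrier[OF gh(1) x] rep_action_carrier[OF gh(2) y]
      by (intro eq_vecI) auto
    then show "orbit G (rep_action \<sigma>) x = orbit G (rep_action \<sigma>) y"
      using orbit_rep_action gh x y by metis
  qed
qed

section \<open>Descent to orbits and the embedding\<close>

text \<open>Invariance allows \<open>y\<close> to be replaced by any \<open>g y\<close> in the bound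
  on vectors, and the infimum is then taken.\<close>

lemma le_orbit_dist:
  assumes "invariant_map G n \<sigma> \<Phi>" "y \<in> carrier_vec n"
    and "\<And>z. z \<in> carrier_vec n \<Longrightarrow> eucl_norm (\<Phi> x - \<Phi> z) \<le> eucl_norm (x - z)"
  shows "eucl_norm (\<Phi> x - \<Phi> y) \<le> orbit_dist G \<sigma> x y"
  unfolding orbit_dist_def
proof (rule cINF_greatest)
  fix g assume g: "g \<in> carrier G"
  then have "\<Phi> (rep_action \<sigma> g y) = \<Phi> y"
    using assms(1,2) unfolding invariant_map_def by blast
  then show "eucl_norm (\<Phi> x - \<Phi> y) \<le> eucl_norm (x - rep_action \<sigma> g y)"
    using assms(3)[OF rep_action_carrier[OF g assms(2)]] by simp
qed (use one_closed in auto)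

lemma inj_on_induced_map:
  assumes "invariant_map G n \<sigma> \<Phi>"
    and "\<And>x y. x \<in> carrier_vec n \<Longrightarrow> y \<in> carrier_vec n \<Longrightarrow> \<Phi> x = \<Phi> y \<Longrightarrow>
      orbit G (rep_action \<sigma>) x = orbit G (rep_action \<sigma>) y"
  shows "inj_on (induced_map \<Phi>) (orbit_space G n \<sigma>)"
  unfolding orbit_space_def orbits_def
proof (rule inj_onI)
  fix X Y
  assume "X \<in> {orbit G (rep_action \<sigma>) x |x. x \<in> carrier_vec n}"
    and "Y \<in> {orbit G (rep_action \<sigma>) x |x. x \<in> carrier_vec n}"
    and eq: "induced_map \<Phi> X = induced_map \<Phi> Y"
  then obtain x y where x: "x \<in> carrier_vec n" "X = orbit G (rep_action \<sigma>) x"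
    and y: "y \<in> carrier_vec n" "Y = orbit G (rep_action \<sigma>) y"
    by blast
  then have "\<Phi> x = \<Phi> y"
    using eq by (simp add: induced_map_orbit[OF is_group assms(1)])
  then show "X = Y"
    using assms(2)[OF x(1) y(1)] x(2) y(2) by blast
qed

lemma nonexpansive_embedding:
  obtains \<Phi> where "\<Phi> \<in> carrier_vec n \<rightarrow> carrier_vec (2 * n + 1)" "invariant_map G n \<sigma> \<Phi>"
    "inj_on (induced_map \<Phi>) (orbit_space G n \<sigma>)"
    "\<And>x y. x \<in> carrier_vec n \<Longrightarrow> y \<in> carrier_vec n \<Longrightarrow>
      eucl_norm (\<Phi> x - \<Phi> y) \<le> orbit_dist G \<sigma> x y"
proof -
  obtain t :: "nat \<Rightarrow> real" where sep: "\<And>x y. x \<in> carrier_vec n \<Longrightarrow> y \<in> carrier_vec n \<Longrightarrow>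
      \<forall>j<4 * n. max_filter G n \<sigma> (t j) x = max_filter G n \<sigma> (t j) y \<Longrightarrow>
      orbit G (rep_action \<sigma>) x = orbit G (rep_action \<sigma>) y"
    using max_filters_separate by blast
  let ?f = "\<lambda>j. max_filter G n \<sigma> (t j)"
  have "\<exists>B\<ge>0. \<forall>x\<in>carrier_vec n. \<forall>y\<in>carrier_vec n. \<bar>?f j x - ?f j y\<bar> \<le> B * eucl_norm (x - y)" for j
    by (rule max_filter_lipschitz[of "t j"]) blast
  then obtain B where B: "\<And>j. B j \<ge> 0" "\<And>j x y. x \<in> carrier_vec n \<Longrightarrow> y \<in> carrier_vec n \<Longrightarrow>
      \<bar>?f j x - ?f j y\<bar> \<le> B j * eucl_norm (x - y)"
    by metis
  \<comment> \<open>The norm of a difference is at most the sum of its coordinate moduli, so before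
    scaling the Lipschitz constant is at most \<open>L - 1\<close>; the summand \<open>1\<close>
    keeps \<open>L\<close> positive when every \<open>B\<close> is zero.\<close>
  define L where "L = 1 + (\<Sum>i<2 * n + 1. B (2 * i) + B (2 * i + 1))"
  have L: "L > 0"
    unfolding L_def using B(1) by (intro add_pos_nonneg sum_nonneg) (auto intro: add_nonneg_nonneg)
  define \<Phi> where
    "\<Phi> x = vec (2 * n + 1) (\<lambda>i. Complex (?f (2 * i) x / L) (?f (2 * i + 1) x / L))" for x
  have inv: "invariant_map G n \<sigma> \<Phi>"
    using max_filter_invariant unfolding invariant_map_def \<Phi>_def by simp
  have "eucl_norm (\<Phi> x - \<Phi> y) \<le> eucl_norm (x - y)" if x: "x \<in> carrier_vec n" and y: "y \<in> carrier_vec n" for x y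
  proof -
    have "eucl_norm (\<Phi> x - \<Phi> y) \<le> (\<Sum>i<2 * n + 1. cmod ((\<Phi> x - \<Phi> y) $ i))"
      using eucl_norm_le_sum[of "\<Phi> x - \<Phi> y"] by (simp add: \<Phi>_def)
    also have "\<dots> \<le> (\<Sum>i<2 * n + 1. (B (2 * i) + B (2 * i + 1)) * eucl_norm (x - y) / L)"
    proof (rule sum_mono)
      fix i assume "i \<in> {..<2 * n + 1}"
      then have "cmod ((\<Phi> x - \<Phi> y) $ i)
        \<le> \<bar>?f (2 * i) x / L - ?f (2 * i) y / L\<bar> + \<bar>?f (2 * i + 1) x / L - ?f (2 * i + 1) y / L\<bar>"
        using cmod_le[of "(\<Phi> x - \<Phi> y) $ i"] by (simp add: \<Phi>_def)
      also have "\<dots> = (\<bar>?f (2 * i) x - ?f (2 * i) y\<bar> + \<bar>?f (2 * i + 1) x - ?f (2 * i + 1) y\<bar>) / L"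
        using L by (simp flip: add_divide_distrib diff_divide_distrib)
      also have "\<dots> \<le> (B (2 * i) + B (2 * i + 1)) * eucl_norm (x - y) / L"
        using L B(2)[OF x y, of "2 * i"] B(2)[OF x y, of "2 * i + 1"]
        by (intro divide_right_mono) (auto simp: distrib_right)
      finally show "cmod ((\<Phi> x - \<Phi> y) $ i) \<le> (B (2 * i) + B (2 * i + 1)) * eucl_norm (x - y) / L" .
    qed
    also have "\<dots> = (L - 1) * eucl_norm (x - y) / L"
      unfolding L_def by (simp only: sum_distrib_right sum_divide_distrib add_diff_cancel_left')
    also have "\<dots> \<le> eucl_norm (x - y)"
      using L eucl_norm_nonneg[of "x - y"] by (simp add: pos_divide_le_eq left_diff_distrib mult.commute)
    finally show ?thesis .
  qed
  then have "eucl_norm (\<Phi> x - \<Phi> y) \<le> orbit_dist G \<sigma> x y"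
    if "x \<in> carrier_vec n" "y \<in> carrier_vec n" for x y
    using le_orbit_dist[OF inv] that by blast
  moreover have "inj_on (induced_map \<Phi>) (orbit_space G n \<sigma>)"
  proof (rule inj_on_induced_map[OF inv])
    fix x y assume xy: "x \<in> carrier_vec n" "y \<in> carrier_vec n" and eq: "\<Phi> x = \<Phi> y"
    have "?f j x = ?f j y" if "j < 4 * n" for j
    \<comment> \<open>Filter \<open>j\<close> is the real or imaginary part of coordinate
      \<open>j div 2\<close>, up to the factor \<open>L\<close>.\<close>
    proof -
      have "j div 2 < 2 * n + 1"
        using that by linarith
      then have "Complex (?f (2 * (j div 2)) x / L) (?f (2 * (j div 2) + 1) x / L)
        = Complex (?f (2 * (j div 2)) y / L) (?f (2 * (j div 2) + 1) y / L)"
        using arg_cong[OF eq, of "\<lambda>v. v $ (j div 2)"] by (simp add: \<Phi>_def)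
      then have "?f (2 * (j div 2)) x = ?f (2 * (j div 2)) y"
        "?f (2 * (j div 2) + 1) x = ?f (2 * (j div 2) + 1) y"
        using L by auto
      moreover have "j = 2 * (j div 2) \<or> j = 2 * (j div 2) + 1"
        by presburger
      ultimately show ?thesis
        by metis
    qed
    then show "orbit G (rep_action \<sigma>) x = orbit G (rep_action \<sigma>) y"
      using sep xy by blast
  qed
  moreover have "\<Phi> \<in> carrier_vec n \<rightarrow> carrier_vec (2 * n + 1)"
    by (simp add: \<Phi>_def)
  ultimately show ?thesis
    using that inv by blast
qed

end

theorem theorem1p1:
  fixes m :: nat
  assumes "m \<ge> 1"
  shows "\<exists>C::real. C > 0 \<and>
    (\<forall>n::nat. n \<ge> 1 \<longrightarrow>
      (\<forall>\<sigma>. unitary_rep (integer_mod_group m) n \<sigma> \<longrightarrow>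
        (\<exists>\<Phi>. \<Phi> \<in> carrier_vec n \<rightarrow> carrier_vec (2 * n + 1) \<and>
          invariant_map (integer_mod_group m) n \<sigma> \<Phi> \<and>
          inj_on (induced_map \<Phi>) (orbit_space (integer_mod_group m) n \<sigma>) \<and>
          (\<forall>x\<in>carrier_vec n. \<forall>y\<in>carrier_vec n.
            eucl_norm (\<Phi> x - \<Phi> y) \<le> C * orbit_dist (integer_mod_group m) \<sigma> x y))))"
proof (intro exI[of _ "1::real"] conjI allI impI)
  fix n :: nat and \<sigma>
  assume "unitary_rep (integer_mod_group m) n \<sigma>"
  \<comment> \<open>For \<open>m \<ge> 1\<close> the carrier is the finite set of residues;
    \<open>integer_mod_group 0\<close> would be the group of all integers.\<close>
  then interpret finite_unitary_rep "integer_mod_group m" n \<sigma>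
    using assms by unfold_locales (auto simp: carrier_integer_mod_group)
  show "\<exists>\<Phi>. \<Phi> \<in> carrier_vec n \<rightarrow> carrier_vec (2 * n + 1) \<and>
      invariant_map (integer_mod_group m) n \<sigma> \<Phi> \<and>
      inj_on (induced_map \<Phi>) (orbit_space (integer_mod_group m) n \<sigma>) \<and>
      (\<forall>x\<in>carrier_vec n. \<forall>y\<in>carrier_vec n.
        eucl_norm (\<Phi> x - \<Phi> y) \<le> 1 * orbit_dist (integer_mod_group m) \<sigma> x y)"
    unfolding mult_1_left by (rule nonexpansive_embedding) blast
qed simp

end
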